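(* Let $\alpha\in(\frac14,\frac13]$ and $\mathbf{X}\in\mathbf{PBRP}^3_\alpha$. Let $F\in C_b^3(\mathbb{R}^n;\mathbb{R}^n)$ and let $\mathbf{Y}:[0,T]\to(\mathcal{H}^{\le2})^n$ be an $\mathbf{X}$-controlled planarly branched rough path above $Y:[0,T]\to\mathbb{R}^n$. Define $\mathbf{Z}:[0,T]\to(\mathcal{H}^{\le2})^n$ by $$\mathbf{Z}^{\mathbb{1}}_t:=F(\mathbf{Y}^{\mathbb{1}}_t),\quad\mathbf{Z}^{\bullet_a}_t:=F'(\mathbf{Y}^{\mathbb{1}}_t)\mathbf{Y}^{\bullet_a}_t,\quad\mathbf{Z}^{[\bullet_b]_a}_t:=F'(\mathbf{Y}^{\mathbb{1}}_t)\mathbf{Y}^{[\bullet_b]_a}_t,$$ $$\mathbf{Z}^{\bullet_a\bullet_b}_t:=F'(\mathbf{Y}^{\mathbb{1}}_t)\mathbf{Y}^{\bullet_a\bullet_b}_t+F''(\mathbf{Y}^{\mathbb{1}}_t)\mathbf{Y}^{\bullet_a}_t\mathbf{Y}^{\bullet_b}_t,\qquad\forall a,b\in A.$$ Then $\mathbf{Z}$ is an $\mathbf{X}$-controlled planarly branched rough path above $F(Y)$, denoted by $F(\mathbf{Y})$.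
   Context: Fix integers $d,n\ge1$, a set $A$ with $d$ elements, $\alpha\in(\frac14,\frac13]$ and $T>0$. Forests. A planar forest is a finite ordered sequence (word) of planar rooted trees with vertices decorated by $A$; $\mathcal{F}$ is the set of these, $\mathbb{1}$ the empty forest, $|\tau|$ the number of vertices, $\mathcal{F}^{\le k}=\{\tau\in\mathcal F:|\tau|\le k\}$. $\bullet_a$ is the one-vertex tree decorated by $a$, and $[\bullet_b]_a$ is the two-vertex tree with root decorated by $a$ and leaf decorated by $b$. Thus $\mathcal{F}^{\le2}=\{\mathbb{1},\bullet_a,\bullet_a\bullet_b,[\bullet_b]_a:a,b\in A\}$. On $\mathbb{R}\mathcal{F}$, ⧢ is the shuffle product of words whose letters are trees. The Munthe-Kaas–Wright coproduct $\Delta$: for a tree $\tau$, $\Delta(\tau)=\tau\otimes\mathbb{1}+\sum_cP^c(\tau)\otimes T^c(\tau)$, where $c$ ranges over left-admissible cuts, i.e. sets of edges (possibly empty) such that (1) with each edge $e\in c$, every other edge outgoing from the same vertex and to the left of $e$ is in $c$; (2) each path from the root to a leaf contains at most one edge of $c$; $T^c(\tau)$ is the component containing the root, and $P^c(\tau)$ is obtained by keeping the planar order of the subtrees cut off from the same vertex and shuffling together the forests cut off from different vertices. For a forest $\omega$, $\Delta(\omega)=(\mathrm{id}\otimes B_-)(\Delta(B_+(\omega))-B_+(\omega)\otimes\mathbb{1})$, where $B_+$ grafts all trees of $\omega$ onto a new root and $B_-$ is its inverse. Write $\mathcal{H}^{\le k}=\mathbb{R}\mathcal{F}^{\le k}$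 and $\mathcal{H}^{*\le k}$ for its dual, with pairing $\langle\tau,\tau'\rangle=\delta_{\tau,\tau'}$. $\mathcal{H}^{\le3}$ carries the truncated shuffle product (forests with more than 3 vertices are set to $0$), and $\star$ on $\mathcal{H}^{*\le3}$ is dual to $\Delta$: $\langle x\star y,\tau\rangle=\langle x\otimes y,\Delta\tau\rangle$. Rough paths. An $\alpha$-Hölder planarly branched rough path is a map $\mathbf{X}:[0,T]^2\to\mathcal{H}^{*\le3}$, with $\mathbf{X}^\tau_{s,t}:=\langle\mathbf{X}_{s,t},\tau\rangle$, such that for all $\sigma,\tau\in\mathcal{F}^{\le3}$ and $s,t,u\in[0,T]$: $\mathbf{X}_{s,u}\star\mathbf{X}_{u,t}=\mathbf{X}_{s,t}$; $\langle\mathbf{X}_{s,t},\sigma$ ⧢ $\tau\rangle=\langle\mathbf{X}_{s,t},\sigma\rangle\langle\mathbf{X}_{s,t},\tau\rangle$ (⧢ being the product of $\mathcal{H}^{\le3}$); and $\sup_{s\ne t}|\mathbf{X}^\tau_{s,t}|/|t-s|^{|\tau|\alpha}<\infty$. $\mathbf{PBRP}^3_\alpha$ is the set of these. Controlled paths. For a path $\mathbf{Y}:[0,T]\to(\mathcal{H}^{\le2})^n$ write $\mathbf{Y}^\tau_t=\langle\tau,\mathbf{Y}_t\rangle\in\mathbb{R}^n$, $\mathbf{Y}^\tau_{s,t}=\mathbf{Y}^\tau_t-\mathbf{Y}^\tau_s$, and $$R\mathbf{Y}^{\mathbb{1}}_{s,t}=\mathbf{Y}^{\mathbb{1}}_{s,t}-\sum_{a\in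 A}\mathbf{Y}^{\bullet_a}_s\mathbf{X}^{\bullet_a}_{s,t}-\sum_{a,b\in A}\mathbf{Y}^{\bullet_a\bullet_b}_s\mathbf{X}^{\bullet_a\bullet_b}_{s,t}-\sum_{a,b\in A}\mathbf{Y}^{[\bullet_b]_a}_s\mathbf{X}^{[\bullet_b]_a}_{s,t},$$ $$R\mathbf{Y}^{\bullet_a}_{s,t}=\mathbf{Y}^{\bullet_a}_{s,t}-\sum_{b\in A}(\mathbf{Y}^{\bullet_a\bullet_b}_s+\mathbf{Y}^{[\bullet_b]_a}_s)\mathbf{X}^{\bullet_b}_{s,t},\quad R\mathbf{Y}^{\bullet_a\bullet_b}_{s,t}=\mathbf{Y}^{\bullet_a\bullet_b}_{s,t},\quad R\mathbf{Y}^{[\bullet_b]_a}_{s,t}=\mathbf{Y}^{[\bullet_b]_a}_{s,t}.$$ $\mathbf{Y}$ is an $\mathbf{X}$-controlled planarly branched rough path if $\sup_{s\ne t}|R\mathbf{Y}^\tau_{s,t}|/|t-s|^{(3-|\tau|)\alpha}<\infty$ for all $\tau\in\mathcal{F}^{\le2}$. It is above the path $Y$ if $\mathbf{Y}^{\mathbb{1}}_t=Y_t$. $C_b^3(\mathbb{R}^n;\mathbb{R}^n)$ is the space of three times continuously differentiable maps $F:\mathbb{R}^n\to\mathbb{R}^n$ with $\|F\|_\infty+\|F'\|_\infty+\|F''\|_\infty+\|F'''\|_\infty<\infty$, where $\|\cdot\|_\infty$ is the supremum norm over $\mathbb{R}^n$. $F',F''$ are Fréchet derivatives, and $F''(x)uv$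 means the bilinear map $F''(x)$ applied to $(u,v)$. *)

theory Defs
  imports "HOL-Analysis.Analysis" "HOL-Library.Multiset" "HOL-Library.Sublist"
begin

section \<open>Planar forests\<close>

datatype 'a ptree = Node (root_label: 'a) (children: "'a ptree list")

type_synonym 'a forest = "'a ptree list"

fun tree_size :: "'a ptree \<Rightarrow> nat" where
  "tree_size (Node a ts) = Suc (sum_list (map tree_size ts))"

definition forest_size :: "'a forest \<Rightarrow> nat" where
  "forest_size \<omega> = sum_list (map tree_size \<omega>)"

definition forests_upto :: "nat \<Rightarrow> 'a forest set" where
  "forests_upto k = {\<omega>. forest_size \<omega> \<le> k}"

abbreviation leaf :: "'a \<Rightarrow> 'a ptree" where
  "leaf a \<equiv> Node a []"

text \<open>\<open>ladder a b\<close> is the tree $[\bullet_b]_a$: the root carries \<open>a\<close>, the leaf carries \<open>b\<close>.\<close>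

abbreviation ladder :: "'a \<Rightarrow> 'a \<Rightarrow> 'a ptree" where
  "ladder a b \<equiv> Node a [Node b []]"

text \<open>
  A family of coefficients indexed by forests and vanishing on forests with more than \<open>k\<close>
  vertices. With real coefficients this is $\mathcal H^{\le k}$ and, through the pairing
  $\langle\tau,\tau'\rangle=\delta_{\tau,\tau'}$, also its dual $\mathcal H^{*\le k}$;
  with coefficients in $\mathbb R^n$ it is $(\mathcal H^{\le k})^n$.
\<close>

definition truncated_space :: "nat \<Rightarrow> ('a forest \<Rightarrow> 'b::zero) set" where
  "truncated_space k = {x. \<forall>\<tau>. \<tau> \<notin> forests_upto k \<longrightarrow> x \<tau> = 0}"

section \<open>Shuffle product\<close>

text \<open>
  The shuffle product and the coproduct of basis elements have coefficients in the natural
  numbers; such elements of $\mathbb R\mathcal F$ and of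
  $\mathbb R\mathcal F\otimes\mathbb R\mathcal F$ are written as multisets of forests
  and of pairs of forests, so that the multiplicity is the coefficient.
\<close>

fun shuffle :: "'b list \<Rightarrow> 'b list \<Rightarrow> 'b list multiset" where
  "shuffle [] ys = {#ys#}"
| "shuffle (x # xs) [] = {#x # xs#}"
| "shuffle (x # xs) (y # ys) =
     image_mset ((#) x) (shuffle xs (y # ys)) + image_mset ((#) y) (shuffle (x # xs) ys)"

definition shuffle_list :: "'b list list \<Rightarrow> 'b list multiset" where
  "shuffle_list ws = foldr (\<lambda>w M. \<Sum>m\<in>#M. shuffle w m) ws {#[]#}"

definition trunc_shuffle :: "nat \<Rightarrow> 'a forest \<Rightarrow> 'a forest \<Rightarrow> 'a forest multiset" where
  "trunc_shuffle k \<sigma> \<tau> = {#\<omega> \<in># shuffle \<sigma> \<tau>. \<omega> \<in> forests_upto k#}"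

definition pairing :: "('a forest \<Rightarrow> real) \<Rightarrow> 'a forest multiset \<Rightarrow> real" where
  "pairing x M = (\<Sum>\<omega>\<in>#M. x \<omega>)"

section \<open>Munthe-Kaas--Wright coproduct\<close>

text \<open>
  A vertex is the list of child indices leading to it from the root, with children numbered
  from left to right starting at 0. An edge is identified with its endpoint
  farther from the root.
\<close>

fun vertices :: "'a ptree \<Rightarrow> nat list list" where
  "vertices (Node a ts) =
     [] # concat (map2 (\<lambda>i vs. map ((#) i) vs) [0..<length ts] (map vertices ts))"

fun subtree :: "'a ptree \<Rightarrow> nat list \<Rightarrow> 'a ptree" where
  "subtree t [] = t"
| "subtree t (i # v) = subtree (children t ! i) v"

definition edges :: "'a ptree \<Rightarrow> nat list set" where
  "edges t = set (vertices t) - {[]}"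

definition leaves :: "'a ptree \<Rightarrow> nat list set" where
  "leaves t = {v \<in> set (vertices t). children (subtree t v) = []}"

definition left_admissible_cuts :: "'a ptree \<Rightarrow> nat list set set" where
  "left_admissible_cuts t = {c \<in> Pow (edges t).
     (\<forall>v i j. v @ [i] \<in> c \<and> j < i \<longrightarrow> v @ [j] \<in> c) \<and>
     (\<forall>l \<in> leaves t. card {e \<in> c. prefix e l} \<le> 1)}"

text \<open>
  The forest cut off from the vertex \<open>v\<close>, in planar order; $P^c$ shuffles these forests over
  all vertices.
\<close>

definition cut_forest :: "nat list set \<Rightarrow> 'a ptree \<Rightarrow> nat list \<Rightarrow> 'a forest" where
  "cut_forest c t v =
     map (\<lambda>i. subtree t (v @ [i]))
       (filter (\<lambda>i. v @ [i] \<in> c) [0..<length (children (subtree t v))])"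

definition pruned :: "nat list set \<Rightarrow> 'a ptree \<Rightarrow> 'a forest multiset" where
  "pruned c t = shuffle_list (map (cut_forest c t) (vertices t))"

lemma zip_size_less [termination_simp]:
  "(i, t) \<in> set (zip is ts) \<Longrightarrow> size t < Suc (size_list size ts)"
  by (drule set_zip_rightD, drule size_list_estimation'[OF _ order_refl, of _ _ size]) simp

fun trunk :: "nat list set \<Rightarrow> 'a ptree \<Rightarrow> 'a ptree" where
  "trunk c (Node a ts) =
     Node a (map (\<lambda>(i, t). trunk {v. i # v \<in> c} t)
       (filter (\<lambda>(i, t). [i] \<notin> c) (zip [0..<length ts] ts)))"

definition tree_coproduct :: "'a ptree \<Rightarrow> ('a forest \<times> 'a forest) multiset" where
  "tree_coproduct t = {#([t], [])#} +
     (\<Sum>c\<in>left_admissible_cuts t. image_mset (\<lambda>\<omega>. (\<omega>, [trunk c t])) (pruned c t))"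

definition B_plus :: "'a \<Rightarrow> 'a forest \<Rightarrow> 'a ptree" where
  "B_plus r \<omega> = Node r \<omega>"

fun B_minus :: "'a forest \<Rightarrow> 'a forest" where
  "B_minus [Node r \<omega>] = \<omega>"

text \<open>
  The decoration \<open>r\<close> of the auxiliary root is irrelevant; see \<open>coproduct_root_irrelevant\<close>.
  On a one-tree word the formula returns \<open>tree_coproduct\<close>: cutting the new edge gives the
  term $\tau\otimes\mathbb 1$.
\<close>

definition coproduct_via_root :: "'a \<Rightarrow> 'a forest \<Rightarrow> ('a forest \<times> 'a forest) multiset" where
  "coproduct_via_root r \<omega> =
     image_mset (map_prod id B_minus) (tree_coproduct (B_plus r \<omega>) - {#([B_plus r \<omega>], [])#})"

definition coproduct :: "'a forest \<Rightarrow> ('a forest \<times> 'a forest) multiset" where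
  "coproduct \<omega> = coproduct_via_root undefined \<omega>"

lemma image_mset_sum: "image_mset f (\<Sum>c\<in>C. g c) = (\<Sum>c\<in>C. image_mset f (g c))"
  by (induction C rule: infinite_finite_induct) auto

lemma coproduct_root_irrelevant: "coproduct \<omega> = coproduct_via_root r \<omega>"
proof -
  have vs: "vertices (Node r \<omega>) = vertices (Node r' \<omega>)" for r r' :: 'a
    by simp
  have sub: "subtree (Node r \<omega>) (v @ [i]) = subtree (Node r' \<omega>) (v @ [i])" for r r' :: 'a and v i
    by (cases v) auto
  have ch: "children (subtree (Node r \<omega>) v) = children (subtree (Node r' \<omega>) v)" for r r' :: 'a and v
    by (cases v) auto
  have cuts: "left_admissible_cuts (Node r \<omega>) = left_admissible_cuts (Node r' \<omega>)" for r r' :: 'a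
    unfolding left_admissible_cuts_def edges_def leaves_def
    by (simp only: vs[of r r'] ch[of r _ r'])
  have pr: "pruned c (Node r \<omega>) = pruned c (Node r' \<omega>)" for r r' :: 'a and c
  proof -
    have "cut_forest c (Node r \<omega>) = cut_forest c (Node r' \<omega>)"
      unfolding cut_forest_def by (intro ext) (simp only: sub[of r _ _ r'] ch[of r _ r'])
    then show ?thesis unfolding pruned_def by (simp only: vs[of r r'])
  qed
  have "coproduct_via_root r \<omega> = (\<Sum>c\<in>left_admissible_cuts (Node r \<omega>).
          image_mset (\<lambda>p. (p, children (trunk c (Node r \<omega>)))) (pruned c (Node r \<omega>)))" for r :: 'a
    unfolding coproduct_via_root_def tree_coproduct_def B_plus_def
    by (simp add: image_mset_sum image_mset.compositionality comp_def)
  then show ?thesis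
    unfolding coproduct_def using cuts[of r undefined] pr[of _ r undefined] by simp
qed

definition star :: "('a forest \<Rightarrow> real) \<Rightarrow> ('a forest \<Rightarrow> real) \<Rightarrow> 'a forest \<Rightarrow> real" where
  "star x y \<tau> =
     (if \<tau> \<in> forests_upto 3 then (\<Sum>(\<sigma>, \<rho>)\<in>#coproduct \<tau>. x \<sigma> * y \<rho>) else 0)"

section \<open>Planarly branched rough paths\<close>

text \<open>
  The shuffle relation is imposed for $|\sigma|+|\tau|\le 3$. Imposing it for all
  $\sigma,\tau\in\mathcal F^{\le3}$, with products of more than three vertices read as 0,
  gives a stronger condition, under which \<open>X\<close> vanishes on all nonempty forests; see
  \<open>PBRP3I_all_shuffles\<close> and \<open>all_shuffles_degenerate\<close>.
  Paths on $[0,T]$ are total functions on the reals, of which only the values on $[0,T]$ matter.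
\<close>

definition PBRP3 :: "real \<Rightarrow> real \<Rightarrow> (real \<Rightarrow> real \<Rightarrow> 'a forest \<Rightarrow> real) set" where
  "PBRP3 \<alpha> T = {X.
     (\<forall>s\<in>{0..T}. \<forall>t\<in>{0..T}. X s t \<in> truncated_space 3) \<and>
     (\<forall>s\<in>{0..T}. \<forall>t\<in>{0..T}. \<forall>u\<in>{0..T}. star (X s u) (X u t) = X s t) \<and>
     (\<forall>s\<in>{0..T}. \<forall>t\<in>{0..T}. \<forall>\<sigma>\<in>forests_upto 3. \<forall>\<tau>\<in>forests_upto 3.
        forest_size \<sigma> + forest_size \<tau> \<le> 3 \<longrightarrow>
        pairing (X s t) (trunc_shuffle 3 \<sigma> \<tau>) = X s t \<sigma> * X s t \<tau>) \<and>
     (\<forall>\<tau>\<in>forests_upto 3. bdd_above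
        {\<bar>X s t \<tau>\<bar> / \<bar>t - s\<bar> powr (real (forest_size \<tau>) * \<alpha>) | s t.
           s \<in> {0..T} \<and> t \<in> {0..T} \<and> s \<noteq> t})}"

lemma PBRP3I_all_shuffles:
  assumes "\<And>s t. s \<in> {0..T} \<Longrightarrow> t \<in> {0..T} \<Longrightarrow> X s t \<in> truncated_space 3"
    and "\<And>s t u. s \<in> {0..T} \<Longrightarrow> t \<in> {0..T} \<Longrightarrow> u \<in> {0..T} \<Longrightarrow> star (X s u) (X u t) = X s t"
    and "\<And>s t \<sigma> \<tau>. s \<in> {0..T} \<Longrightarrow> t \<in> {0..T} \<Longrightarrow> \<sigma> \<in> forests_upto 3 \<Longrightarrow> \<tau> \<in> forests_upto 3 \<Longrightarrow>
           pairing (X s t) (trunc_shuffle 3 \<sigma> \<tau>) = X s t \<sigma> * X s t \<tau>"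
    and "\<And>\<tau>. \<tau> \<in> forests_upto 3 \<Longrightarrow> bdd_above
           {\<bar>X s t \<tau>\<bar> / \<bar>t - s\<bar> powr (real (forest_size \<tau>) * \<alpha>) | s t.
              s \<in> {0..T} \<and> t \<in> {0..T} \<and> s \<noteq> t}"
  shows "X \<in> PBRP3 \<alpha> T"
  unfolding PBRP3_def using assms by (intro CollectI conjI ballI impI) assumption+

lemma forest_size_shuffle: "\<omega> \<in># shuffle \<sigma> \<tau> \<Longrightarrow> forest_size \<omega> = forest_size \<sigma> + forest_size \<tau>"
  by (induction \<sigma> \<tau> arbitrary: \<omega> rule: shuffle.induct) (auto simp: forest_size_def)

lemma trunc_shuffle_eq:
  "trunc_shuffle k \<sigma> \<tau> = (if forest_size \<sigma> + forest_size \<tau> \<le> k then shuffle \<sigma> \<tau> else {#})"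
proof -
  have "trunc_shuffle k \<sigma> \<tau> =
          {#\<omega> \<in># shuffle \<sigma> \<tau>. forest_size \<sigma> + forest_size \<tau> \<le> k#}"
    unfolding trunc_shuffle_def forests_upto_def
    by (rule filter_mset_cong) (auto simp: forest_size_shuffle)
  then show ?thesis by simp
qed

lemma all_shuffles_degenerate:
  assumes mult: "\<And>\<sigma> \<tau>. \<sigma> \<in> forests_upto 3 \<Longrightarrow> \<tau> \<in> forests_upto 3 \<Longrightarrow>
      pairing x (trunc_shuffle 3 \<sigma> \<tau>) = x \<sigma> * x \<tau>"
    and \<tau>: "\<tau> \<in> forests_upto 3" "\<tau> \<noteq> []"
  shows "x \<tau> = 0"
proof -
  have big: "x \<tau> = 0" if "\<tau> \<in> forests_upto 3" "forest_size \<tau> \<ge> 2" for \<tau>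
    using mult[OF that(1) that(1)] that by (simp add: trunc_shuffle_eq pairing_def)
  show ?thesis
  proof (cases "forest_size \<tau> \<ge> 2")
    case False
    have pos: "tree_size t \<ge> 1" for t :: "'a ptree"
      by (cases t) simp
    obtain t ts where ts: "\<tau> = t # ts"
      using \<tau>(2) by (cases \<tau>) auto
    have "ts = []"
    proof (cases ts)
      case (Cons u us)
      then have "forest_size \<tau> = tree_size t + tree_size u + forest_size us"
        using ts by (simp add: forest_size_def)
      then show ?thesis using False pos[of t] pos[of u] by linarith
    qed
    then have t: "\<tau> = [t]" "forest_size \<tau> = 1"
      using ts False pos[of t] by (simp_all add: forest_size_def)
    have "x [t, t] = 0"
      using t by (intro big) (auto simp: forests_upto_def forest_size_def)
    with mult[OF \<tau>(1) \<tau>(1)] t show ?thesis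
      by (simp add: trunc_shuffle_eq pairing_def)
  qed (use big \<tau> in auto)
qed

section \<open>Controlled paths\<close>

fun remainder :: "(real \<Rightarrow> real \<Rightarrow> 'a::finite forest \<Rightarrow> real) \<Rightarrow>
    (real \<Rightarrow> 'a forest \<Rightarrow> real ^ 'n) \<Rightarrow> 'a forest \<Rightarrow> real \<Rightarrow> real \<Rightarrow> real ^ 'n" where
  "remainder X Y [] s t = Y t [] - Y s []
     - (\<Sum>a\<in>UNIV. X s t [leaf a] *\<^sub>R Y s [leaf a])
     - (\<Sum>a\<in>UNIV. \<Sum>b\<in>UNIV. X s t [leaf a, leaf b] *\<^sub>R Y s [leaf a, leaf b])
     - (\<Sum>a\<in>UNIV. \<Sum>b\<in>UNIV. X s t [ladder a b] *\<^sub>R Y s [ladder a b])"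
| "remainder X Y [leaf a] s t = Y t [leaf a] - Y s [leaf a]
     - (\<Sum>b\<in>UNIV. X s t [leaf b] *\<^sub>R (Y s [leaf a, leaf b] + Y s [ladder a b]))"
| "remainder X Y [leaf a, leaf b] s t = Y t [leaf a, leaf b] - Y s [leaf a, leaf b]"
| "remainder X Y [ladder a b] s t = Y t [ladder a b] - Y s [ladder a b]"

definition controlled :: "real \<Rightarrow> real \<Rightarrow> (real \<Rightarrow> real \<Rightarrow> 'a::finite forest \<Rightarrow> real) \<Rightarrow>
    (real \<Rightarrow> 'a forest \<Rightarrow> real ^ 'n) \<Rightarrow> bool" where
  "controlled \<alpha> T X Y \<longleftrightarrow>
     (\<forall>t\<in>{0..T}. Y t \<in> truncated_space 2) \<and>
     (\<forall>\<tau>\<in>forests_upto 2. bdd_above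
        {norm (remainder X Y \<tau> s t) / \<bar>t - s\<bar> powr ((3 - real (forest_size \<tau>)) * \<alpha>) | s t.
           s \<in> {0..T} \<and> t \<in> {0..T} \<and> s \<noteq> t})"

definition is_above :: "real \<Rightarrow> (real \<Rightarrow> 'a forest \<Rightarrow> real ^ 'n) \<Rightarrow> (real \<Rightarrow> real ^ 'n) \<Rightarrow> bool" where
  "is_above T Y y \<longleftrightarrow> (\<forall>t\<in>{0..T}. Y t [] = y t)"

section \<open>Differentiable maps\<close>

text \<open>
  The Frechet derivative as a bounded linear map, meaningful where \<open>f\<close> is differentiable.
  Second and third derivatives arise by iteration, so that $F''(x)uv$ is
  \<open>D (D F) x u v\<close>, with \<open>blinfun_apply\<close> inserted as a coercion.
\<close>

definition D :: "('b::real_normed_vector \<Rightarrow> 'c::real_normed_vector) \<Rightarrow> 'b \<Rightarrow> 'b \<Rightarrow>\<^sub>L 'c" where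
  "D f x = Blinfun (frechet_derivative f (at x))"

definition Cb3 :: "('b::real_normed_vector \<Rightarrow> 'c::real_normed_vector) set" where
  "Cb3 = {F.
     (\<forall>x. F differentiable (at x)) \<and>
     (\<forall>x. D F differentiable (at x)) \<and>
     (\<forall>x. D (D F) differentiable (at x)) \<and>
     continuous_on UNIV (D (D (D F))) \<and>
     bounded (range F) \<and> bounded (range (D F)) \<and>
     bounded (range (D (D F))) \<and> bounded (range (D (D (D F))))}"

end

theory Submission
  imports Defs
begin

text \<open>
  Let \<open>P = \<Sum>a. X\<^sup>a Y\<^sup>a\<close> be the first order part of the increment \<open>\<delta>Y\<close>, so that
  \<open>\<delta>Y - P\<close> is \<open>2\<alpha>\<close>-Hoelder. In the third order Taylor expansion of \<open>F(Y)\<close> the quadratic term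
  \<open>F''(Y)(\<delta>Y, \<delta>Y)/2\<close> equals \<open>F''(Y)(P, P)/2\<close> up to an error of order \<open>3\<alpha>\<close>. By the shuffle
  relation \<open>X\<^sup>a X\<^sup>b = X\<^sup>a\<^sup>b + X\<^sup>b\<^sup>a\<close> and the symmetry of \<open>F''\<close>, the latter is
  \<open>\<Sum>a b. X\<^sup>a\<^sup>b F''(Y)(Y\<^sup>a, Y\<^sup>b)\<close>, which is the extra term in the coefficient of \<open>Z\<close> at the
  forest of two leaves. The coefficient at a single leaf is treated by the first order expansion of
  \<open>F'(Y)\<close>, again using symmetry, and the remaining ones by the Lipschitz continuity of \<open>F'\<close> and \<open>F''\<close>.
\<close>

section \<open>Taylor estimates for maps with bounded derivatives\<close>

lemma has_derivative_D:
  assumes "f differentiable (at x)"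
  shows "(f has_derivative blinfun_apply (D f x)) (at x)"
proof -
  have d: "(f has_derivative frechet_derivative f (at x)) (at x)"
    using assms by (simp add: frechet_derivative_works)
  then show ?thesis
    unfolding D_def by (simp add: bounded_linear_Blinfun_apply has_derivative_bounded_linear)
qed

lemma blinfun_apply_diff: "blinfun_apply (f - g) = (\<lambda>h. f h - g h)"
  by (simp add: fun_eq_iff blinfun.diff_left)

text \<open>Mean value inequality on the convex set \<open>closed_segment x y\<close>. Asking for
  the bound only on the segment lets \<open>B\<close> depend on \<open>x\<close> and
  \<open>y\<close>, which is how the Taylor lemmas gain their powers of
  \<open>norm (y - x)\<close>.\<close>

lemma norm_diff_le_segment:
  fixes f :: "'b::real_normed_vector \<Rightarrow> 'c::real_normed_vector"
  assumes der: "\<And>z. (f has_derivative blinfun_apply (f' z)) (at z)"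
    and bound: "\<And>z. z \<in> closed_segment x y \<Longrightarrow> norm (f' z) \<le> B"
  shows "norm (f y - f x) \<le> B * norm (y - x)"
proof (rule differentiable_bound[of "closed_segment x y" f "\<lambda>z. blinfun_apply (f' z)"])
  show "(f has_derivative blinfun_apply (f' z)) (at z within closed_segment x y)" for z
    using der by (rule has_derivative_at_withinI)
  show "onorm (blinfun_apply (f' z)) \<le> B" if "z \<in> closed_segment x y" for z
    using bound[OF that] by (simp add: norm_blinfun.rep_eq)
qed auto

lemma D_lipschitz:
  fixes f :: "'b::real_normed_vector \<Rightarrow> 'c::real_normed_vector"
  assumes "\<And>x. f differentiable (at x)" and "\<And>x. norm (D f x) \<le> B"
  shows "norm (f y - f x) \<le> B * norm (y - x)"
  by (rule norm_diff_le_segment[of f "D f"]) (simp_all add: has_derivative_D assms)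

text \<open>Subtracting the linear map \<open>D f x\<close> from \<open>f\<close> leaves the
  derivative \<open>D f z - D f x\<close>, which is at most \<open>B * norm (y - x)\<close> on the
  segment.\<close>

lemma taylor_order2:
  fixes f :: "'b::real_normed_vector \<Rightarrow> 'c::real_normed_vector"
  assumes diff: "\<And>x. f differentiable (at x)"
    and lip: "\<And>x y. norm (D f y - D f x) \<le> B * norm (y - x)" and B: "0 \<le> B"
  shows "norm (f y - f x - D f x (y - x)) \<le> B * (norm (y - x))\<^sup>2"
proof -
  let ?g = "\<lambda>z. f z - D f x z"
  have "norm (?g y - ?g x) \<le> (B * norm (y - x)) * norm (y - x)"
  proof (rule norm_diff_le_segment[of _ "\<lambda>z. D f z - D f x"])
    show "(?g has_derivative blinfun_apply (D f z - D f x)) (at z)" for z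
      unfolding blinfun_apply_diff
      by (intro has_derivative_diff has_derivative_D diff bounded_linear_imp_has_derivative
          blinfun.bounded_linear_right)
    show "norm (D f z - D f x) \<le> B * norm (y - x)" if "z \<in> closed_segment x y" for z
      using lip[of z x] mult_left_mono[OF segment_bound(1)[OF that] B] by linarith
  qed
  then show ?thesis
    by (simp add: blinfun.diff_right power2_eq_square algebra_simps)
qed

text \<open>
  Both \<open>D (D f) x u v\<close> and \<open>D (D f) x v u\<close> approximate the symmetric second difference
  \<open>f (x + u + v) - f (x + u) - f (x + v) + f x\<close> up to a third order error.
\<close>

lemma second_difference_bound:
  fixes f :: "'b::real_normed_vector \<Rightarrow> 'c::real_normed_vector"
  assumes diff: "\<And>x. f differentiable (at x)" and diff': "\<And>x. D f differentiable (at x)"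
    and lip: "\<And>x y. norm (D (D f) y - D (D f) x) \<le> B * norm (y - x)" and B: "0 \<le> B"
  shows "norm (f (x + u + v) - f (x + u) - f (x + v) + f x - D (D f) x v u)
    \<le> 2 * B * (norm u + norm v) ^ 3"
proof -
  \<comment> \<open>The increment of \<open>?g\<close> from \<open>x\<close> to \<open>x + u\<close>
    is the quantity to be bounded. Its derivative at \<open>z\<close> is
    \<open>?E (z + v) - ?E z\<close>, a difference of two first order Taylor remainders of
    \<open>D f\<close> at \<open>x\<close>, and \<open>?r\<close> bounds the distance of both points
    from \<open>x\<close>.\<close>
  let ?g = "\<lambda>z. f (z + v) - f z - D (D f) x v z"
  let ?E = "\<lambda>z. D f z - D f x - D (D f) x (z - x)"
  let ?r = "norm u + norm v"
  have E: "norm (?E z) \<le> B * ?r\<^sup>2" if "norm (z - x) \<le> ?r" for z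
  proof -
    have "norm (?E z) \<le> B * (norm (z - x))\<^sup>2"
      by (rule taylor_order2[OF diff' lip B])
    also have "\<dots> \<le> B * ?r\<^sup>2"
      by (intro mult_left_mono power_mono that B) simp
    finally show ?thesis .
  qed
  have "norm (?g (x + u) - ?g x) \<le> (2 * B * ?r\<^sup>2) * norm ((x + u) - x)"
  proof (rule norm_diff_le_segment[of _ "\<lambda>z. D f (z + v) - D f z - D (D f) x v"])
    show "(?g has_derivative blinfun_apply (D f (z + v) - D f z - D (D f) x v)) (at z)" for z
    proof -
      have "((\<lambda>z. f (z + v)) has_derivative (\<lambda>h. D f (z + v) h)) (at z)"
        by (rule has_derivative_compose[of "\<lambda>z. z + v" "\<lambda>h. h", OF _ has_derivative_D[OF diff]])
          (auto intro!: derivative_eq_intros)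
      then show ?thesis
        unfolding blinfun_apply_diff
        by (intro has_derivative_diff has_derivative_D diff bounded_linear_imp_has_derivative
            blinfun.bounded_linear_right)
    qed
    show "norm (D f (z + v) - D f z - D (D f) x v) \<le> 2 * B * ?r\<^sup>2"
      if z: "z \<in> closed_segment x (x + u)" for z
    proof -
      have zx: "norm (z - x) \<le> norm u" using segment_bound(1)[OF z] by simp
      have "norm (z + v - x) \<le> norm (z - x) + norm v"
        using norm_triangle_ineq[of "z - x" v] by (simp add: algebra_simps)
      then have 1: "norm (?E (z + v)) \<le> B * ?r\<^sup>2" using zx by (intro E) linarith
      have 2: "norm (?E z) \<le> B * ?r\<^sup>2" using zx by (intro E) (simp add: add_increasing2)
      have "D f (z + v) - D f z - D (D f) x v = ?E (z + v) - ?E z"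
        by (simp add: blinfun.diff_right blinfun.add_right)
      then show ?thesis using norm_triangle_ineq4[of "?E (z + v)" "?E z"] 1 2 by (simp only:)
    qed
  qed
  also have "\<dots> \<le> (2 * B * ?r\<^sup>2) * ?r"
    using B by (intro mult_left_mono) auto
  finally show ?thesis
    by (simp add: blinfun.add_right power3_eq_cube power2_eq_square algebra_simps)
qed

text \<open>The difference of the two sides is quadratic under joint scaling of \<open>u\<close> and
  \<open>v\<close>, but the second difference bounds it by a cubic quantity. Scaling both vectors by
  \<open>r\<close> and dividing by \<open>r\<^sup>2\<close> bounds it by \<open>r * K\<close>, which
  tends to 0.\<close>

lemma D_D_symmetric:
  fixes f :: "'b::real_normed_vector \<Rightarrow> 'c::real_normed_vector"
  assumes diff: "\<And>x. f differentiable (at x)" and diff': "\<And>x. D f differentiable (at x)"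
    and lip: "\<And>x y. norm (D (D f) y - D (D f) x) \<le> B * norm (y - x)" and B: "0 \<le> B"
  shows "D (D f) x u v = D (D f) x v u"
proof -
  define N where "N = norm (D (D f) x u v - D (D f) x v u)"
  define K where "K = 4 * B * (norm u + norm v) ^ 3"
  \<comment> \<open>Stated for all vectors, since it is applied to \<open>r *\<^sub>R u\<close> and
    \<open>r *\<^sub>R v\<close>. The second difference \<open>?q\<close> is unchanged when
    \<open>u\<close> and \<open>v\<close> are exchanged.\<close>
  have bound: "norm (D (D f) x u v - D (D f) x v u) \<le> 4 * B * (norm u + norm v) ^ 3" for u v
  proof -
    let ?q = "f (x + u + v) - f (x + u) - f (x + v) + f x"
    have "norm (?q - D (D f) x v u) \<le> 2 * B * (norm u + norm v) ^ 3"
      by (rule second_difference_bound[OF diff diff' lip B])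
    moreover have "norm (?q - D (D f) x u v) \<le> 2 * B * (norm u + norm v) ^ 3"
      using second_difference_bound[OF diff diff' lip B, of x v u] by (simp add: algebra_simps)
    ultimately show ?thesis
      using norm_triangle_ineq4[of "?q - D (D f) x v u" "?q - D (D f) x u v"] by simp
  qed
  have "N \<le> r * K" if r: "r > 0" for r
  proof -
    have "r\<^sup>2 * N = norm (D (D f) x (r *\<^sub>R u) (r *\<^sub>R v) - D (D f) x (r *\<^sub>R v) (r *\<^sub>R u))"
      using r by (simp add: N_def blinfun.scaleR_left blinfun.scaleR_right power2_eq_square
          flip: scaleR_diff_right)
    also have "\<dots> \<le> 4 * B * (norm (r *\<^sub>R u) + norm (r *\<^sub>R v)) ^ 3" by (rule bound)
    also have "\<dots> = r\<^sup>2 * (r * K)"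
      using r by (simp add: K_def power3_eq_cube power2_eq_square algebra_simps)
    finally show ?thesis using r by simp
  qed
  moreover have "((\<lambda>r. r * K) \<longlongrightarrow> 0 * K) (at_right 0)" by (intro tendsto_intros)
  ultimately have "N \<le> 0 * K"
    by (intro tendsto_lowerbound[of "\<lambda>r. r * K" _ "at_right 0"])
      (auto simp: eventually_at_right_less intro: eventually_at_rightI[of 0 1])
  then show ?thesis by (simp add: N_def)
qed

text \<open>The derivative of \<open>f\<close> minus its second order Taylor polynomial is the first
  order remainder of \<open>D f\<close>, which \<open>taylor_order2\<close> bounds
  quadratically.\<close>

lemma taylor_order3:
  fixes f :: "'b::real_normed_vector \<Rightarrow> 'c::real_normed_vector"
  assumes diff: "\<And>x. f differentiable (at x)" and diff': "\<And>x. D f differentiable (at x)"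
    and lip: "\<And>x y. norm (D (D f) y - D (D f) x) \<le> B * norm (y - x)" and B: "0 \<le> B"
  shows "norm (f y - f x - D f x (y - x) - (1/2) *\<^sub>R D (D f) x (y - x) (y - x))
    \<le> B * norm (y - x) ^ 3"
proof -
  let ?g = "\<lambda>z. f z - D f x z - (1/2) *\<^sub>R D (D f) x (z - x) (z - x)"
  let ?E = "\<lambda>z. D f z - D f x - D (D f) x (z - x)"
  have "norm (?g y - ?g x) \<le> (B * (norm (y - x))\<^sup>2) * norm (y - x)"
  proof (rule norm_diff_le_segment[of _ ?E])
    show "(?g has_derivative blinfun_apply (?E z)) (at z)" for z
    proof -
      have sub: "((\<lambda>z. z - x) has_derivative (\<lambda>h. h)) (at z)"
        by (auto intro!: derivative_eq_intros)
      have "((\<lambda>z. D (D f) x (z - x)) has_derivative (\<lambda>h. D (D f) x h)) (at z)"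
        using bounded_linear.has_derivative[OF blinfun.bounded_linear_right sub] .
      \<comment> \<open>The product rule yields two terms with \<open>h\<close> in either slot;
        symmetry makes them equal and cancels the factor 1/2.\<close>
      from has_derivative_scaleR_right[OF blinfun.FDERIV[OF this sub], of "1/2"]
      have q: "((\<lambda>z. (1/2) *\<^sub>R D (D f) x (z - x) (z - x)) has_derivative
          (\<lambda>h. D (D f) x (z - x) h)) (at z)"
        by (simp add: D_D_symmetric[OF diff diff' lip B, of x _ "z - x"] flip: scaleR_2)
      show ?thesis
        unfolding blinfun_apply_diff
        by (intro has_derivative_diff has_derivative_D diff bounded_linear_imp_has_derivative
            blinfun.bounded_linear_right q)
    qed
    show "norm (?E z) \<le> B * (norm (y - x))\<^sup>2" if "z \<in> closed_segment x y" for z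
    proof -
      have "norm (?E z) \<le> B * (norm (z - x))\<^sup>2" by (rule taylor_order2[OF diff' lip B])
      also have "\<dots> \<le> B * (norm (y - x))\<^sup>2"
        by (intro mult_left_mono power_mono segment_bound(1) that B) simp
      finally show ?thesis .
    qed
  qed
  then show ?thesis
    by (simp add: blinfun.diff_right power3_eq_cube power2_eq_square algebra_simps)
qed

section \<open>Hoelder estimates for two-parameter maps\<close>

text \<open>The diagonal is excluded because \<open>0 powr 0 = 0\<close>; thus exponent 0 means boundedness.\<close>

definition holder_bound :: "real \<Rightarrow> real \<Rightarrow> (real \<Rightarrow> real \<Rightarrow> 'b::real_normed_vector) \<Rightarrow> bool" where
  "holder_bound T p f \<longleftrightarrow>
     (\<exists>C. \<forall>s\<in>{0..T}. \<forall>t\<in>{0..T}. s \<noteq> t \<longrightarrow> norm (f s t) \<le> C * \<bar>t - s\<bar> powr p)"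

lemma holder_boundI:
  assumes "\<And>s t. s \<in> {0..T} \<Longrightarrow> t \<in> {0..T} \<Longrightarrow> s \<noteq> t \<Longrightarrow> norm (f s t) \<le> C * \<bar>t - s\<bar> powr p"
  shows "holder_bound T p f"
  using assms unfolding holder_bound_def by blast

lemma holder_boundE:
  assumes "holder_bound T p f"
  obtains C where "0 \<le> C"
    and "\<And>s t. s \<in> {0..T} \<Longrightarrow> t \<in> {0..T} \<Longrightarrow> s \<noteq> t \<Longrightarrow> norm (f s t) \<le> C * \<bar>t - s\<bar> powr p"
proof -
  obtain C where C: "\<And>s t. s \<in> {0..T} \<Longrightarrow> t \<in> {0..T} \<Longrightarrow> s \<noteq> t \<Longrightarrow>
      norm (f s t) \<le> C * \<bar>t - s\<bar> powr p"
    using assms unfolding holder_bound_def by blast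
  have "norm (f s t) \<le> \<bar>C\<bar> * \<bar>t - s\<bar> powr p" if "s \<in> {0..T}" "t \<in> {0..T}" "s \<noteq> t" for s t
    using C[OF that] mult_right_mono[OF abs_ge_self[of C], of "\<bar>t - s\<bar> powr p"] by simp
  then show thesis using that[of "\<bar>C\<bar>"] by simp
qed

lemma bdd_above_iff_holder_bound:
  "bdd_above {norm (f s t) / \<bar>t - s\<bar> powr p | s t. s \<in> {0..T} \<and> t \<in> {0..T} \<and> s \<noteq> t}
    \<longleftrightarrow> holder_bound T p f"
proof -
  have "bdd_above {norm (f s t) / \<bar>t - s\<bar> powr p | s t. s \<in> {0..T} \<and> t \<in> {0..T} \<and> s \<noteq> t}
    \<longleftrightarrow> (\<exists>C. \<forall>s\<in>{0..T}. \<forall>t\<in>{0..T}. s \<noteq> t \<longrightarrow> norm (f s t) / \<bar>t - s\<bar> powr p \<le> C)"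
    unfolding bdd_above_def by blast
  also have "\<dots> \<longleftrightarrow> holder_bound T p f"
    unfolding holder_bound_def
    by (intro ex_cong1 ball_cong refl imp_cong) (simp add: pos_divide_le_eq)
  finally show ?thesis .
qed

text \<open>Equality is asked for only on the interval because the coefficients of \<open>ZZ\<close>
  are prescribed only there.\<close>

lemma holder_bound_cong:
  assumes "\<And>s t. s \<in> {0..T} \<Longrightarrow> t \<in> {0..T} \<Longrightarrow> f s t = g s t"
  shows "holder_bound T p f \<longleftrightarrow> holder_bound T p g"
  using assms unfolding holder_bound_def by auto

lemma holder_bound_le:
  assumes "holder_bound T p f" and "\<And>s t. s \<in> {0..T} \<Longrightarrow> t \<in> {0..T} \<Longrightarrow> norm (g s t) \<le> K * norm (f s t)"
    and "0 \<le> K"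
  shows "holder_bound T p g"
proof -
  from assms(1) obtain C where C: "\<And>s t. s \<in> {0..T} \<Longrightarrow> t \<in> {0..T} \<Longrightarrow> s \<noteq> t \<Longrightarrow>
      norm (f s t) \<le> C * \<bar>t - s\<bar> powr p"
    by (rule holder_boundE) blast
  show ?thesis
  proof (rule holder_boundI[where C = "K * C"])
    fix s t assume st: "s \<in> {0..T}" "t \<in> {0..T}" "s \<noteq> t"
    have "norm (g s t) \<le> K * norm (f s t)" using assms(2) st by simp
    also have "\<dots> \<le> K * (C * \<bar>t - s\<bar> powr p)" using C[OF st] assms(3) by (rule mult_left_mono)
    finally show "norm (g s t) \<le> K * C * \<bar>t - s\<bar> powr p" by (simp add: mult.assoc)
  qed
qed

section \<open>Sums, products and comparison of exponents\<close>

lemma holder_bound_add: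
  assumes "holder_bound T p f" and "holder_bound T p g"
  shows "holder_bound T p (\<lambda>s t. f s t + g s t)"
proof -
  obtain C where C: "\<And>s t. s \<in> {0..T} \<Longrightarrow> t \<in> {0..T} \<Longrightarrow> s \<noteq> t \<Longrightarrow>
      norm (f s t) \<le> C * \<bar>t - s\<bar> powr p"
    using assms(1) by (rule holder_boundE) blast
  obtain C' where C': "\<And>s t. s \<in> {0..T} \<Longrightarrow> t \<in> {0..T} \<Longrightarrow> s \<noteq> t \<Longrightarrow>
      norm (g s t) \<le> C' * \<bar>t - s\<bar> powr p"
    using assms(2) by (rule holder_boundE) blast
  show ?thesis
  proof (rule holder_boundI[where C = "C + C'"])
    fix s t assume st: "s \<in> {0..T}" "t \<in> {0..T}" "s \<noteq> t"
    show "norm (f s t + g s t) \<le> (C + C') * \<bar>t - s\<bar> powr p"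
      using C[OF st] C'[OF st] norm_triangle_ineq[of "f s t" "g s t"]
      by (simp add: distrib_right)
  qed
qed

lemma holder_bound_zero: "holder_bound T p (\<lambda>s t. 0)"
  by (rule holder_boundI[where C = 0]) simp

lemma holder_bound_sum:
  assumes "\<And>i. i \<in> I \<Longrightarrow> holder_bound T p (f i)"
  shows "holder_bound T p (\<lambda>s t. \<Sum>i\<in>I. f i s t)"
  using assms
  by (induction I rule: infinite_finite_induct) (simp_all add: holder_bound_zero holder_bound_add)

text \<open>Exponents add under any bounded bilinear product; this covers real multiplication,
  scaling and the application of bounded linear maps.\<close>

lemma (in bounded_bilinear) holder_bound:
  assumes "holder_bound T p f" and "holder_bound T q g"
  shows "holder_bound T (p + q) (\<lambda>s t. prod (f s t) (g s t))"
proof -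
  obtain K where K: "0 \<le> K" "\<And>a b. norm (prod a b) \<le> norm a * norm b * K"
    using nonneg_bounded by blast
  obtain C where C: "0 \<le> C" "\<And>s t. s \<in> {0..T} \<Longrightarrow> t \<in> {0..T} \<Longrightarrow> s \<noteq> t \<Longrightarrow>
      norm (f s t) \<le> C * \<bar>t - s\<bar> powr p"
    using assms(1) by (rule holder_boundE) blast
  obtain C' where C': "0 \<le> C'" "\<And>s t. s \<in> {0..T} \<Longrightarrow> t \<in> {0..T} \<Longrightarrow> s \<noteq> t \<Longrightarrow>
      norm (g s t) \<le> C' * \<bar>t - s\<bar> powr q"
    using assms(2) by (rule holder_boundE) blast
  show ?thesis
  proof (rule holder_boundI[where C = "C * C' * K"])
    fix s t assume st: "s \<in> {0..T}" "t \<in> {0..T}" "s \<noteq> t"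
    have "norm (prod (f s t) (g s t)) \<le> norm (f s t) * norm (g s t) * K" by (rule K(2))
    also have "\<dots> \<le> (C * \<bar>t - s\<bar> powr p) * (C' * \<bar>t - s\<bar> powr q) * K"
      using C(1) K(1) by (intro mult_mono mult_right_mono C(2) C'(2) st) auto
    finally show "norm (prod (f s t) (g s t)) \<le> C * C' * K * \<bar>t - s\<bar> powr (p + q)"
      by (simp add: powr_add mult_ac)
  qed
qed

lemma holder_bound_norm_power:
  assumes "holder_bound T p f"
  shows "holder_bound T (real n * p) (\<lambda>s t. norm (f s t) ^ n)"
proof (induction n)
  case 0
  show ?case by (rule holder_boundI[where C = 1]) simp
next
  case (Suc n)
  have "holder_bound T p (\<lambda>s t. norm (f s t))"
    using assms by (simp add: holder_bound_def)
  from bounded_bilinear.holder_bound[OF bounded_bilinear_mult this Suc]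
  show ?case by (simp add: algebra_simps)
qed

text \<open>The surplus factor \<open>\<bar>t - s\<bar> powr (p - q)\<close> is at most
  \<open>T powr (p - q)\<close> on the bounded interval.\<close>

lemma holder_bound_mono:
  assumes "holder_bound T p f" and "q \<le> p"
  shows "holder_bound T q f"
proof -
  obtain C where C: "0 \<le> C" "\<And>s t. s \<in> {0..T} \<Longrightarrow> t \<in> {0..T} \<Longrightarrow> s \<noteq> t \<Longrightarrow>
      norm (f s t) \<le> C * \<bar>t - s\<bar> powr p"
    using assms(1) by (rule holder_boundE) blast
  show ?thesis
  proof (rule holder_boundI[where C = "C * T powr (p - q)"])
    fix s t assume st: "s \<in> {0..T}" "t \<in> {0..T}" "s \<noteq> t"
    have "\<bar>t - s\<bar> powr p = \<bar>t - s\<bar> powr (p - q) * \<bar>t - s\<bar> powr q"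
      by (simp flip: powr_add)
    also have "\<dots> \<le> T powr (p - q) * \<bar>t - s\<bar> powr q"
      using st assms(2) by (intro mult_right_mono powr_mono2) auto
    finally have "C * \<bar>t - s\<bar> powr p \<le> C * (T powr (p - q) * \<bar>t - s\<bar> powr q)"
      using C(1) by (rule mult_left_mono)
    then show "norm (f s t) \<le> C * T powr (p - q) * \<bar>t - s\<bar> powr q"
      using C(2)[OF st] by (simp add: mult.assoc)
  qed
qed

section \<open>Bounds obtained from paths\<close>

lemma holder_bound_of_bounded:
  assumes "\<And>s t. s \<in> {0..T} \<Longrightarrow> t \<in> {0..T} \<Longrightarrow> norm (f s t) \<le> C"
  shows "holder_bound T 0 f"
  using assms by (intro holder_boundI[where C = C]) simp

text \<open>Comparison with the value at 0 bounds the path. The result is phrased as a two-parameter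
  map of exponent 0 so that coefficients at time \<open>s\<close> can enter the product
  rules.\<close>

lemma holder_bound_path_left:
  assumes "holder_bound T p (\<lambda>s t. y t - y s)" and "0 \<le> p"
  shows "holder_bound T 0 (\<lambda>s t. y s)"
proof -
  obtain C where C: "0 \<le> C" "\<And>s t. s \<in> {0..T} \<Longrightarrow> t \<in> {0..T} \<Longrightarrow> s \<noteq> t \<Longrightarrow>
      norm (y t - y s) \<le> C * \<bar>t - s\<bar> powr 0"
    using holder_bound_mono[OF assms] by (rule holder_boundE) blast
  show ?thesis
  proof (rule holder_bound_of_bounded[where C = "norm (y 0) + C"])
    fix s t assume "s \<in> {0..T}" "t \<in> {0..T}"
    \<comment> \<open>The case \<open>s = 0\<close> is separate because the increment bound excludes
      the diagonal.\<close>
    then have "norm (y s - y 0) \<le> C" using C(1) C(2)[of 0 s] by (cases "s = 0") auto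
    then show "norm (y s) \<le> norm (y 0) + C"
      using norm_triangle_ineq2[of "y s" "y 0"] by linarith
  qed
qed

text \<open>Turns a bound for a path read at \<open>s\<close> into one for the path read at
  \<open>t\<close>.\<close>

lemma holder_bound_swap:
  assumes "holder_bound T p f"
  shows "holder_bound T p (\<lambda>s t. f t s)"
proof -
  obtain C where C: "0 \<le> C" "\<And>s t. s \<in> {0..T} \<Longrightarrow> t \<in> {0..T} \<Longrightarrow> s \<noteq> t \<Longrightarrow>
      norm (f s t) \<le> C * \<bar>t - s\<bar> powr p"
    using assms by (rule holder_boundE) blast
  show ?thesis
  proof (rule holder_boundI[where C = C])
    fix s t assume "s \<in> {0..T}" "t \<in> {0..T}" "s \<noteq> t"
    then show "norm (f t s) \<le> C * \<bar>t - s\<bar> powr p"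
      using C(2)[of t s] by (simp add: abs_minus_commute)
  qed
qed

text \<open>The exponent \<open>r\<close> is a variable of its own so that the rule matches goals
  such as \<open>3 * \<alpha>\<close> and leaves the arithmetic as a premise.\<close>

lemma holder_bound_blinfun:
  assumes "holder_bound T p f" and "holder_bound T q g" and "r = p + q"
  shows "holder_bound T r (\<lambda>s t. blinfun_apply (f s t) (g s t))"
  unfolding assms(3) using assms(1,2) by (rule blinfun.holder_bound)

lemma holder_bound_scaleR:
  assumes "holder_bound T p f" and "holder_bound T q g" and "r = p + q"
  shows "holder_bound T r (\<lambda>s t. f s t *\<^sub>R g s t)"
  unfolding assms(3) using assms(1,2)
  by (rule bounded_bilinear.holder_bound[OF bounded_bilinear_scaleR])

text \<open>Product rule for increments, with one factor frozen at \<open>t\<close> and the other at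
  \<open>s\<close>. Applied twice, it handles \<open>D (D F)\<close> evaluated on two moving
  vectors.\<close>

lemma holder_bound_blinfun_path:
  assumes A: "holder_bound T p (\<lambda>s t. A t - A s)" and v: "holder_bound T p (\<lambda>s t. v t - v s)"
    and p: "0 \<le> p"
  shows "holder_bound T p (\<lambda>s t. blinfun_apply (A t) (v t) - blinfun_apply (A s) (v s))"
proof -
  have "holder_bound T p (\<lambda>s t. A t (v t - v s) + (A t - A s) (v s))"
    by (intro holder_bound_add holder_bound_blinfun[where p = 0 and q = p]
        holder_bound_blinfun[where p = p and q = 0] A v
        holder_bound_swap[OF holder_bound_path_left[OF A p]] holder_bound_path_left[OF v p]) simp_all
  then show ?thesis by (simp add: blinfun.diff_left blinfun.diff_right)
qed

section \<open>Controlled paths\<close>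

text \<open>The root of the first tree takes one vertex, so its children and the remaining trees
  share at most one more.\<close>

lemma forests_upto_2_cases:
  assumes "\<tau> \<in> forests_upto 2"
  obtains "\<tau> = []" | a where "\<tau> = [leaf a]" | a b where "\<tau> = [leaf a, leaf b]"
    | a b where "\<tau> = [ladder a b]"
proof -
  have pos: "tree_size t \<ge> 1" for t :: "'a ptree" by (cases t) simp
  have nonempty: "forest_size (t # ts) \<ge> 1" for t and ts :: "'a forest"
    using pos[of t] by (simp add: forest_size_def)
  have size0: "\<omega> = []" if "forest_size \<omega> = 0" for \<omega> :: "'a forest"
    using that nonempty[of "hd \<omega>" "tl \<omega>"] by (cases \<omega>) auto
  have node: "tree_size (Node a ts) = Suc (forest_size ts)" for a and ts :: "'a forest"
    by (simp add: forest_size_def)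
  have size1: "\<exists>a. \<omega> = [leaf a]" if "forest_size \<omega> = 1" for \<omega> :: "'a forest"
  proof (cases \<omega>)
    case (Cons t ts)
    obtain a us where t: "t = Node a us" by (cases t)
    have "forest_size us = 0" "forest_size ts = 0"
      using that by (simp_all add: Cons t forest_size_def)
    then show ?thesis using size0 Cons t by blast
  qed (use that in \<open>simp add: forest_size_def\<close>)
  show thesis
  proof (cases \<tau>)
    case (Cons t ts)
    obtain a us where t: "t = Node a us" by (cases t)
    have "forest_size us + forest_size ts \<le> 1"
      using assms by (simp add: Cons t forest_size_def forests_upto_def)
    then consider "forest_size us = 0" "forest_size ts = 0"
      | "forest_size us = 0" "forest_size ts = 1" | "forest_size us = 1" "forest_size ts = 0"
      by linarith
    then show thesis
      using that size0 size1 Cons t by cases blast+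
  qed (use that in blast)
qed

lemma PBRP3_holder_bound:
  assumes "X \<in> PBRP3 \<alpha> T" and "\<tau> \<in> forests_upto 3"
  shows "holder_bound T (real (forest_size \<tau>) * \<alpha>) (\<lambda>s t. X s t \<tau>)"
  using assms unfolding PBRP3_def by (simp flip: bdd_above_iff_holder_bound)

text \<open>Two leaves have total size 2, so truncation at 3 keeps both shuffles.\<close>

lemma PBRP3_shuffle_leaves:
  assumes "X \<in> PBRP3 \<alpha> T" and "s \<in> {0..T}" and "t \<in> {0..T}"
  shows "X s t [leaf a] * X s t [leaf b] = X s t [leaf a, leaf b] + X s t [leaf b, leaf a]"
proof -
  have "pairing (X s t) (trunc_shuffle 3 [leaf a] [leaf b]) = X s t [leaf a] * X s t [leaf b]"
    using assms unfolding PBRP3_def by (auto simp: forests_upto_def forest_size_def)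
  then show ?thesis
    by (simp add: trunc_shuffle_eq pairing_def forest_size_def)
qed

lemma controlled_iff_holder_bound:
  "controlled \<alpha> T X Y \<longleftrightarrow> (\<forall>t\<in>{0..T}. Y t \<in> truncated_space 2) \<and>
     holder_bound T (3 * \<alpha>) (remainder X Y []) \<and>
     (\<forall>a. holder_bound T (2 * \<alpha>) (remainder X Y [leaf a])) \<and>
     (\<forall>a b. holder_bound T \<alpha> (remainder X Y [leaf a, leaf b])) \<and>
     (\<forall>a b. holder_bound T \<alpha> (remainder X Y [ladder a b]))"
proof -
  have "(\<forall>\<tau>\<in>forests_upto 2. Q \<tau>) \<longleftrightarrow> Q [] \<and> (\<forall>a. Q [leaf a]) \<and>
      (\<forall>a b. Q [leaf a, leaf b]) \<and> (\<forall>a b. Q [ladder a b])" for Q :: "'a forest \<Rightarrow> bool"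
  proof
    assume "\<forall>\<tau>\<in>forests_upto 2. Q \<tau>"
    then show "Q [] \<and> (\<forall>a. Q [leaf a]) \<and> (\<forall>a b. Q [leaf a, leaf b]) \<and> (\<forall>a b. Q [ladder a b])"
      by (auto simp: forests_upto_def forest_size_def)
  next
    assume "Q [] \<and> (\<forall>a. Q [leaf a]) \<and> (\<forall>a b. Q [leaf a, leaf b]) \<and> (\<forall>a b. Q [ladder a b])"
    then show "\<forall>\<tau>\<in>forests_upto 2. Q \<tau>"
      by (auto elim: forests_upto_2_cases)
  qed
  note * = this[of "\<lambda>\<tau>. holder_bound T ((3 - real (forest_size \<tau>)) * \<alpha>) (remainder X Y \<tau>)"]
  show ?thesis
    unfolding controlled_def bdd_above_iff_holder_bound *
    by (simp add: forest_size_def)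
qed

text \<open>One constant \<open>B\<close> bounds the first three derivatives. The bounds on the
  second and third derivatives make \<open>D F\<close> and \<open>D (D F)\<close> Lipschitz, and the
  latter property feeds both expansions and the symmetry.\<close>

lemma Cb3_bounds:
  fixes F :: "'b::real_normed_vector \<Rightarrow> 'c::real_normed_vector"
  assumes "F \<in> Cb3"
  obtains B where "0 \<le> B" and "\<And>x. norm (D F x) \<le> B" and "\<And>x. norm (D (D F) x) \<le> B"
    and "\<And>x y. norm (D F y - D F x) \<le> B * norm (y - x)"
    and "\<And>x y. norm (D (D F) y - D (D F) x) \<le> B * norm (y - x)"
    and "\<And>x y. norm (D F y - D F x - D (D F) x (y - x)) \<le> B * (norm (y - x))\<^sup>2"
    and "\<And>x y. norm (F y - F x - D F x (y - x) - (1/2) *\<^sub>R D (D F) x (y - x) (y - x))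
      \<le> B * norm (y - x) ^ 3"
    and "\<And>x u v. D (D F) x u v = D (D F) x v u"
proof -
  have diff: "\<And>x. F differentiable (at x)" "\<And>x. D F differentiable (at x)"
      "\<And>x. D (D F) differentiable (at x)"
    and bdd: "bounded (range (D F))" "bounded (range (D (D F)))" "bounded (range (D (D (D F))))"
    using assms unfolding Cb3_def by auto
  obtain B1 B2 B3 where B: "\<And>x. norm (D F x) \<le> B1" "\<And>x. norm (D (D F) x) \<le> B2"
      "\<And>x. norm (D (D (D F)) x) \<le> B3"
    using bdd unfolding bounded_iff by auto
  define B where "B = max B1 (max B2 B3)"
  have le: "norm (D F x) \<le> B" "norm (D (D F) x) \<le> B" "norm (D (D (D F)) x) \<le> B" for x
    using B[of x] by (auto simp: B_def)
  have nonneg: "0 \<le> B" using order_trans[OF norm_ge_zero le(1)] .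
  note lip = D_lipschitz[OF diff(2) le(2)]
    D_lipschitz[OF diff(3) le(3)]
  show thesis
    by (rule that[OF nonneg le(1,2) lip taylor_order2[OF diff(2) lip(2) nonneg]
          taylor_order3[OF diff(1,2) lip(2) nonneg] D_D_symmetric[OF diff(1,2) lip(2) nonneg]])
qed

theorem proposition2p7:
  fixes \<alpha> T :: real
    and X :: "real \<Rightarrow> real \<Rightarrow> 'a::finite forest \<Rightarrow> real"
    and F :: "real ^ 'n \<Rightarrow> real ^ 'n"
    and YY ZZ :: "real \<Rightarrow> 'a forest \<Rightarrow> real ^ 'n"
    and Y :: "real \<Rightarrow> real ^ 'n"
  assumes "1 / 4 < \<alpha>" and "\<alpha> \<le> 1 / 3" and "T > 0"
    and "X \<in> PBRP3 \<alpha> T"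
    and "F \<in> Cb3"
    and "controlled \<alpha> T X YY" and "is_above T YY Y"
    and "\<And>t. t \<in> {0..T} \<Longrightarrow> ZZ t \<in> truncated_space 2"
    and "\<And>t. t \<in> {0..T} \<Longrightarrow> ZZ t [] = F (YY t [])"
    and "\<And>t a. t \<in> {0..T} \<Longrightarrow> ZZ t [leaf a] = D F (YY t []) (YY t [leaf a])"
    and "\<And>t a b. t \<in> {0..T} \<Longrightarrow> ZZ t [ladder a b] = D F (YY t []) (YY t [ladder a b])"
    and "\<And>t a b. t \<in> {0..T} \<Longrightarrow> ZZ t [leaf a, leaf b] =
           D F (YY t []) (YY t [leaf a, leaf b]) + D (D F) (YY t []) (YY t [leaf a]) (YY t [leaf b])"
  shows "controlled \<alpha> T X ZZ \<and> is_above T ZZ (F \<circ> Y)"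
proof -
  note Z = assms(9-12)
  define y where "y t = YY t []" for t
  define y\<^sub>1 where "y\<^sub>1 a t = YY t [leaf a]" for a t
  define y\<^sub>2 where "y\<^sub>2 a b t = YY t [leaf a, leaf b]" for a b t
  define l where "l a b t = YY t [ladder a b]" for a b t
  define x\<^sub>1 where "x\<^sub>1 a s t = X s t [leaf a]" for a s t
  define x\<^sub>2 where "x\<^sub>2 a b s t = X s t [leaf a, leaf b]" for a b s t
  define xl where "xl a b s t = X s t [ladder a b]" for a b s t
  note defs = y_def y\<^sub>1_def y\<^sub>2_def l_def x\<^sub>1_def x\<^sub>2_def xl_def
  let ?O = "\<lambda>p. holder_bound T p"
  have \<alpha>: "0 \<le> \<alpha>" using assms(1) by simp

  \<comment> \<open>Hoelder regularity of the coefficients of \<open>X\<close> and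
    \<open>YY\<close>\<close>
  have RY: "?O (3 * \<alpha>) (remainder X YY [])" "\<And>a. ?O (2 * \<alpha>) (remainder X YY [leaf a])"
      and dy\<^sub>2: "\<And>a b. ?O \<alpha> (\<lambda>s t. y\<^sub>2 a b t - y\<^sub>2 a b s)" and dl: "\<And>a b. ?O \<alpha> (\<lambda>s t. l a b t - l a b s)"
  proof -
    have "remainder X YY [leaf a, leaf b] = (\<lambda>s t. y\<^sub>2 a b t - y\<^sub>2 a b s)"
      "remainder X YY [ladder a b] = (\<lambda>s t. l a b t - l a b s)" for a b
      by (simp_all add: fun_eq_iff defs)
    then show "?O (3 * \<alpha>) (remainder X YY [])" "\<And>a. ?O (2 * \<alpha>) (remainder X YY [leaf a])"
      "\<And>a b. ?O \<alpha> (\<lambda>s t. y\<^sub>2 a b t - y\<^sub>2 a b s)" "\<And>a b. ?O \<alpha> (\<lambda>s t. l a b t - l a b s)"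
      using assms(6) unfolding controlled_iff_holder_bound by auto
  qed
  have x\<^sub>1: "?O \<alpha> (x\<^sub>1 a)" for a
    using PBRP3_holder_bound[OF assms(4), of "[leaf a]"]
    by (simp add: forests_upto_def forest_size_def defs[abs_def])
  have x\<^sub>2: "?O (2 * \<alpha>) (x\<^sub>2 a b)" and xl: "?O (2 * \<alpha>) (xl a b)" for a b
    using PBRP3_holder_bound[OF assms(4), of "[leaf a, leaf b]"]
      PBRP3_holder_bound[OF assms(4), of "[ladder a b]"]
    by (simp_all add: forests_upto_def forest_size_def defs[abs_def])
  note y\<^sub>2 = holder_bound_path_left[OF dy\<^sub>2 \<alpha>]
  note l = holder_bound_path_left[OF dl \<alpha>]

  \<comment> \<open>The increment is the remainder, of order \<open>2 * \<alpha>\<close>, plus terms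
    of order \<open>\<alpha>\<close> with bounded coefficients.\<close>
  have dy\<^sub>1: "?O \<alpha> (\<lambda>s t. y\<^sub>1 a t - y\<^sub>1 a s)" for a
  proof -
    have "?O \<alpha> (\<lambda>s t. remainder X YY [leaf a] s t + (\<Sum>b\<in>UNIV. x\<^sub>1 b s t *\<^sub>R (y\<^sub>2 a b s + l a b s)))"
      by (intro holder_bound_add holder_bound_mono[OF RY(2)] holder_bound_sum
          holder_bound_scaleR[where p = \<alpha> and q = 0] x\<^sub>1 y\<^sub>2 l) (use \<alpha> in simp_all)
    then show ?thesis by (simp add: defs)
  qed
  note y\<^sub>1 = holder_bound_path_left[OF dy\<^sub>1 \<alpha>]

  define P where "P s t = (\<Sum>a\<in>UNIV. x\<^sub>1 a s t *\<^sub>R y\<^sub>1 a s)" for s t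
  have P: "?O \<alpha> P"
    unfolding P_def[abs_def]
    by (intro holder_bound_sum holder_bound_scaleR[where p = \<alpha> and q = 0] x\<^sub>1 y\<^sub>1) simp
  have dyP: "?O (2 * \<alpha>) (\<lambda>s t. y t - y s - P s t)"
  proof -
    have "?O (2 * \<alpha>) (\<lambda>s t. remainder X YY [] s t
        + (\<Sum>a\<in>UNIV. \<Sum>b\<in>UNIV. x\<^sub>2 a b s t *\<^sub>R y\<^sub>2 a b s)
        + (\<Sum>a\<in>UNIV. \<Sum>b\<in>UNIV. xl a b s t *\<^sub>R l a b s))"
      by (intro holder_bound_add holder_bound_mono[OF RY(1)] holder_bound_sum
          holder_bound_scaleR[where p = "2 * \<alpha>" and q = 0] x\<^sub>2 xl y\<^sub>2 l) (use \<alpha> in simp_all)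
    then show ?thesis by (simp add: defs P_def algebra_simps)
  qed
  have dy: "?O \<alpha> (\<lambda>s t. y t - y s)"
  proof -
    have "?O \<alpha> (\<lambda>s t. (y t - y s - P s t) + P s t)"
      by (intro holder_bound_add holder_bound_mono[OF dyP] P) (use \<alpha> in simp)
    then show ?thesis by simp
  qed

  \<comment> \<open>Expansions of \<open>F\<close> and \<open>D F\<close> along the path\<close>
  obtain B where B: "0 \<le> B" "\<And>x. norm (D F x) \<le> B" "\<And>x. norm (D (D F) x) \<le> B"
    and lip: "\<And>x y. norm (D F y - D F x) \<le> B * norm (y - x)"
      "\<And>x y. norm (D (D F) y - D (D F) x) \<le> B * norm (y - x)"
    and taylor2: "\<And>x y. norm (D F y - D F x - D (D F) x (y - x)) \<le> B * (norm (y - x))\<^sup>2"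
    and taylor3: "\<And>x y. norm (F y - F x - D F x (y - x) - (1/2) *\<^sub>R D (D F) x (y - x) (y - x))
      \<le> B * norm (y - x) ^ 3"
    and sym: "\<And>x u v. D (D F) x u v = D (D F) x v u"
    by (rule Cb3_bounds[OF assms(5)]) (rule that; assumption)
  have F': "?O 0 (\<lambda>s t. D F (y s))" and F'': "?O 0 (\<lambda>s t. D (D F) (y s))"
    by (rule holder_bound_of_bounded[where C = B], simp add: B)+
  have dF': "?O \<alpha> (\<lambda>s t. D F (y t) - D F (y s))"
    and dF'': "?O \<alpha> (\<lambda>s t. D (D F) (y t) - D (D F) (y s))"
    by (rule holder_bound_le[OF dy _ B(1)], rule lip)+
  have F'_taylor: "?O (2 * \<alpha>) (\<lambda>s t. D F (y t) - D F (y s) - D (D F) (y s) (y t - y s))"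
    by (rule holder_bound_le[OF holder_bound_norm_power[OF dy, of 2, simplified] _ B(1)])
      (simp add: taylor2)
  have F_taylor: "?O (3 * \<alpha>) (\<lambda>s t. F (y t) - F (y s) - D F (y s) (y t - y s)
      - (1/2) *\<^sub>R D (D F) (y s) (y t - y s) (y t - y s))"
    by (rule holder_bound_le[OF holder_bound_norm_power[OF dy, of 3, simplified] _ B(1)])
      (simp add: taylor3)

  \<comment> \<open>The four remainders of \<open>ZZ\<close>\<close>
  have Z2: "?O \<alpha> (remainder X ZZ [leaf a, leaf b])" for a b
  proof -
    have "?O \<alpha> (\<lambda>s t. (D F (y t) (y\<^sub>2 a b t) - D F (y s) (y\<^sub>2 a b s))
        + (D (D F) (y t) (y\<^sub>1 a t) (y\<^sub>1 b t) - D (D F) (y s) (y\<^sub>1 a s) (y\<^sub>1 b s)))"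
      by (intro holder_bound_add holder_bound_blinfun_path dF' dF'' dy\<^sub>2 dy\<^sub>1 \<alpha>)
    then show ?thesis
      by (rule holder_bound_cong[THEN iffD1, rotated]) (simp add: Z defs algebra_simps)
  qed

  have Zl: "?O \<alpha> (remainder X ZZ [ladder a b])" for a b
  proof -
    have "?O \<alpha> (\<lambda>s t. D F (y t) (l a b t) - D F (y s) (l a b s))"
      by (intro holder_bound_blinfun_path dF' dl \<alpha>)
    then show ?thesis
      by (rule holder_bound_cong[THEN iffD1, rotated]) (simp add: Z defs)
  qed

  have Z1: "?O (2 * \<alpha>) (remainder X ZZ [leaf a])" for a
  proof -
    \<comment> \<open>Expanding \<open>D F (y t) (y\<^sub>1 a t)\<close> around time
      \<open>s\<close> leaves these four terms, of orders \<open>0 + 2 * \<alpha>\<close>,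
      \<open>\<alpha> + \<alpha>\<close>, \<open>2 * \<alpha> + 0\<close> and
      \<open>2 * \<alpha> + 0\<close>. What they omit is exactly the first order part subtracted in
      the remainder of \<open>ZZ\<close>.\<close>
    have "?O (2 * \<alpha>) (\<lambda>s t. D F (y s) (remainder X YY [leaf a] s t)
        + (D F (y t) - D F (y s)) (y\<^sub>1 a t - y\<^sub>1 a s)
        + (D F (y t) - D F (y s) - D (D F) (y s) (y t - y s)) (y\<^sub>1 a s)
        + D (D F) (y s) (y t - y s - P s t) (y\<^sub>1 a s))"
      by (intro holder_bound_add holder_bound_blinfun[OF F' RY(2)] holder_bound_blinfun[OF dF' dy\<^sub>1]
          holder_bound_blinfun[OF F'_taylor y\<^sub>1]
          holder_bound_blinfun[OF holder_bound_blinfun[OF F'' dyP refl] y\<^sub>1]) simp_all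
    then show ?thesis
    proof (rule holder_bound_cong[THEN iffD1, rotated])
      fix s t assume st: "s \<in> {0..T}" "t \<in> {0..T}"
      \<comment> \<open>Symmetry is needed because \<open>P\<close> sits in the first slot, whereas
        the coefficient of \<open>ZZ\<close> at two leaves has \<open>y\<^sub>1 a\<close>
        there.\<close>
      have "D (D F) (y s) (P s t) (y\<^sub>1 a s) = (\<Sum>b\<in>UNIV. x\<^sub>1 b s t *\<^sub>R D (D F) (y s) (y\<^sub>1 a s) (y\<^sub>1 b s))"
        by (subst sym) (simp add: P_def blinfun.sum_right blinfun.scaleR_right)
      then show "D F (y s) (remainder X YY [leaf a] s t)
          + (D F (y t) - D F (y s)) (y\<^sub>1 a t - y\<^sub>1 a s)
          + (D F (y t) - D F (y s) - D (D F) (y s) (y t - y s)) (y\<^sub>1 a s)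
          + D (D F) (y s) (y t - y s - P s t) (y\<^sub>1 a s) = remainder X ZZ [leaf a] s t"
        using st by (simp add: Z blinfun.bilinear_simps blinfun.sum_right
            scaleR_add_right sum.distrib flip: defs)
    qed
  qed

  have Z0: "?O (3 * \<alpha>) (remainder X ZZ [])"
  proof -
    \<comment> \<open>With \<open>d = y t - y s\<close>, the last bracket is the bilinear identity
      \<open>F''(d, d) - F''(P, P) = F''(d - P, d) + F''(P, d - P)\<close>. Each summand has order
      \<open>2 * \<alpha> + \<alpha>\<close>.\<close>
    have "?O (3 * \<alpha>) (\<lambda>s t. D F (y s) (remainder X YY [] s t)
        + (F (y t) - F (y s) - D F (y s) (y t - y s) - (1/2) *\<^sub>R D (D F) (y s) (y t - y s) (y t - y s))
        + (1/2) *\<^sub>R (D (D F) (y s) (y t - y s - P s t) (y t - y s)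
                   + D (D F) (y s) (P s t) (y t - y s - P s t)))"
      by (intro holder_bound_add F_taylor holder_bound_blinfun[OF F' RY(1)]
          holder_bound_scaleR[OF holder_bound_of_bounded[where C = "1/2"]]
          holder_bound_blinfun[OF holder_bound_blinfun[OF F'' dyP refl] dy]
          holder_bound_blinfun[OF holder_bound_blinfun[OF F'' P refl] dyP]) simp_all
    then show ?thesis
    proof (rule holder_bound_cong[THEN iffD1, rotated])
      fix s t assume st: "s \<in> {0..T}" "t \<in> {0..T}"
      let ?d = "\<lambda>a b. D (D F) (y s) (y\<^sub>1 a s) (y\<^sub>1 b s)"
      have "D (D F) (y s) (P s t) (P s t) = (\<Sum>a\<in>UNIV. \<Sum>b\<in>UNIV. (x\<^sub>1 a s t * x\<^sub>1 b s t) *\<^sub>R ?d a b)"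
        by (simp add: P_def blinfun.sum_right blinfun.sum_left blinfun.scaleR_left
            blinfun.scaleR_right scaleR_sum_right mult.commute)
          (intro sum.cong refl arg_cong2[where f = scaleR] sym)
      also have "\<dots> = (\<Sum>a\<in>UNIV. \<Sum>b\<in>UNIV. x\<^sub>2 a b s t *\<^sub>R ?d a b)
          + (\<Sum>a\<in>UNIV. \<Sum>b\<in>UNIV. x\<^sub>2 b a s t *\<^sub>R ?d a b)"
        using PBRP3_shuffle_leaves[OF assms(4) st]
        by (simp add: x\<^sub>1_def x\<^sub>2_def scaleR_add_left sum.distrib)
      \<comment> \<open>Exchanging the summation indices and using symmetry makes the two shuffle
        sums equal, which absorbs the factor 1/2.\<close>
      also have "(\<Sum>a\<in>UNIV. \<Sum>b\<in>UNIV. x\<^sub>2 b a s t *\<^sub>R ?d a b)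
          = (\<Sum>a\<in>UNIV. \<Sum>b\<in>UNIV. x\<^sub>2 a b s t *\<^sub>R ?d a b)"
        by (subst sum.swap) (simp add: sym)
      finally have PP: "(1/2) *\<^sub>R D (D F) (y s) (P s t) (P s t)
          = (\<Sum>a\<in>UNIV. \<Sum>b\<in>UNIV. x\<^sub>2 a b s t *\<^sub>R ?d a b)"
        by (simp flip: scaleR_2)
      have DP: "D F (y s) (P s t) = (\<Sum>a\<in>UNIV. x\<^sub>1 a s t *\<^sub>R D F (y s) (y\<^sub>1 a s))"
        by (simp add: P_def blinfun.sum_right blinfun.scaleR_right)
      \<comment> \<open>\<open>PP\<close> and \<open>DP\<close> are read backwards here: the sums
        involving \<open>y\<^sub>1\<close> are collected into terms in \<open>P\<close>, so that
        comparison with \<open>RY0\<close> uses only linearity in each slot.\<close>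
      have RZ: "remainder X ZZ [] s t = F (y t) - F (y s) - D F (y s) (P s t)
          - D F (y s) (\<Sum>a\<in>UNIV. \<Sum>b\<in>UNIV. x\<^sub>2 a b s t *\<^sub>R y\<^sub>2 a b s)
          - (1/2) *\<^sub>R D (D F) (y s) (P s t) (P s t)
          - D F (y s) (\<Sum>a\<in>UNIV. \<Sum>b\<in>UNIV. xl a b s t *\<^sub>R l a b s)"
        unfolding PP DP using st
        by (simp add: Z blinfun.sum_right blinfun.scaleR_right scaleR_add_right sum.distrib flip: defs)
      have RY0: "remainder X YY [] s t = y t - y s - P s t
          - (\<Sum>a\<in>UNIV. \<Sum>b\<in>UNIV. x\<^sub>2 a b s t *\<^sub>R y\<^sub>2 a b s)
          - (\<Sum>a\<in>UNIV. \<Sum>b\<in>UNIV. xl a b s t *\<^sub>R l a b s)"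
        by (simp add: P_def defs)
      show "D F (y s) (remainder X YY [] s t)
        + (F (y t) - F (y s) - D F (y s) (y t - y s) - (1/2) *\<^sub>R D (D F) (y s) (y t - y s) (y t - y s))
        + (1/2) *\<^sub>R (D (D F) (y s) (y t - y s - P s t) (y t - y s)
                   + D (D F) (y s) (P s t) (y t - y s - P s t)) = remainder X ZZ [] s t"
        unfolding RZ RY0 by (simp only: blinfun.diff_right blinfun.diff_left) (simp add: algebra_simps)
    qed
  qed
  show ?thesis
    unfolding controlled_iff_holder_bound
    using Z0 Z1 Z2 Zl assms(7-9) by (simp add: is_above_def)
qed

end
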